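(* Let $\alpha,\beta>-1$ and $n\ge 0$. Let $x_0<x_1<\dots<x_n$ be the roots of the Jacobi polynomial $P_{n+1}^{(\alpha,\beta+1)}$. Let $\hat w_1,\tilde w_0,\dots,\tilde w_n$ be the weights of the Gauss-Jacobi-Radau quadrature rule $$\int_{-1}^1(1-x)^\alpha(1+x)^\beta f(x)\,dx\simeq \hat w_1f(-1)+\sum_{j=0}^n\tilde w_jf(x_j).$$ Consider the $n+2$ interpolation points $\{-1\}\cup\{x_j\}_{j=0}^n$; let $\tilde\lambda_j$ denote the barycentric weight belonging to $x_j$, and $\hat\lambda_1$ the one belonging to $-1$. Then $$\tilde\lambda_j=C_n^{(\alpha,\beta+1)}(-1)^{j}\sqrt{(1-x_j)\tilde w_j},\quad j=0,\dots,n,\qquad \hat\lambda_1=-C_n^{(\alpha,\beta+1)}\sqrt{2(\beta+1)\hat w_1},$$ where, for parameters $a,b$, $$C_n^{(a,b)}=\sigma\,\frac{\Gamma(2n+a+b+3)}{2^{\,n+1+\frac{a+b+1}{2}}}\,\frac{1}{\sqrt{(n+1)!\,\Gamma(n+a+b+2)\,\Gamma(n+a+2)\,\Gamma(n+b+2)}},$$ with $\sigma=+1$ for even $n$ and $\sigma=-1$ for odd $n$.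
   Context: The barycentric weight belonging to a point $z$ of a finite set $Z$ of interpolation points is $\prod_{y\in Z,\,y\ne z}(z-y)^{-1}$. The Gauss-Jacobi-Radau rule above is the quadrature rule with nodes $-1,x_0,\dots,x_n$ that is exact for all polynomials of degree at most $2n+2$. *)

theory Defs
  imports "HOL-Analysis.Analysis" "HOL-Computational_Algebra.Polynomial"
begin

(* Szego, Orthogonal Polynomials, (4.3.2): the coefficient form valid for all real a, b,
   normalised by P_n(1) = (n + a gchoose n). *)
definition jacobi_poly :: "nat \<Rightarrow> real \<Rightarrow> real \<Rightarrow> real poly" where
  "jacobi_poly n a b =
     (\<Sum>k\<le>n. smult (((real n + a) gchoose (n - k)) * ((real n + b) gchoose k))
        ([:-1/2, 1/2:] ^ k * [:1/2, 1/2:] ^ (n - k)))"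

definition barycentric_weight :: "real set \<Rightarrow> real \<Rightarrow> real" where
  "barycentric_weight Z z = (\<Prod>y\<in>Z - {z}. inverse (z - y))"

(* v is the weight of the node -1, w j the weight of the node x j. *)
definition gauss_jacobi_radau_rule ::
    "real \<Rightarrow> real \<Rightarrow> nat \<Rightarrow> (nat \<Rightarrow> real) \<Rightarrow> real \<Rightarrow> (nat \<Rightarrow> real) \<Rightarrow> bool" where
  "gauss_jacobi_radau_rule \<alpha> \<beta> n x v w \<longleftrightarrow>
     (\<forall>p :: real poly. degree p \<le> 2 * n + 2 \<longrightarrow>
        ((\<lambda>t. (1 - t) powr \<alpha> * (1 + t) powr \<beta> * poly p t) has_integral
           (v * poly p (-1) + (\<Sum>j\<le>n. w j * poly p (x j)))) {-1..1})"

definition jacobi_const :: "nat \<Rightarrow> real \<Rightarrow> real \<Rightarrow> real" where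
  "jacobi_const n a b =
     (if even n then 1 else -1) *
     (Gamma (2 * real n + a + b + 3) / 2 powr (real n + 1 + (a + b + 1) / 2)) *
     (1 / sqrt (fact (n + 1) * Gamma (real n + a + b + 2) *
                Gamma (real n + a + 2) * Gamma (real n + b + 2)))"

end

theory Submission
  imports Defs
begin

text \<open>
  Let q be the monic polynomial with roots \<open>x\<^sub>0, \<dots>, x\<^sub>n\<close> and write \<open>b = \<beta> + 1\<close>.
  Integrating the derivative of \<open>(1 - t)\<^bsup>\<alpha>+1\<^esup> (1 + t)\<^bsup>\<beta>+1\<^esup> y(t)\<close> shows that
  \<open>(1 - t\<^sup>2) y' + ((\<beta> - \<alpha>) - (\<alpha> + \<beta> + 2) t) y\<close> has weighted integral 0. For
  \<open>y = q\<^sup>2 / (t - x\<^sub>j)\<close> this integrand has degree at most \<open>2n + 2\<close>, and at the nodes only the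
  terms at -1 and at \<open>x\<^sub>j\<close> survive in the quadrature rule. The resulting identity relates
  \<open>w\<^sub>j\<close> to the weight v of the node -1, without any use of orthogonality.
  Applying the rule to the Jacobi polynomial P itself gives v P(-1) as the integral of P, which
  is an explicit sum of Beta integrals, and the leading coefficient of P is a Vandermonde sum.
  For the signs one needs \<open>x\<^sub>j > -1\<close>, which follows by integrating the polynomial
  \<open>(1 + t) (q / (t - x\<^sub>j))\<^sup>2\<close>, nonnegative on the interval.
\<close>

section \<open>Binomial coefficients and a partial fraction sum\<close>

lemma gbinomial_Gamma:
  fixes a :: real
  assumes "a - real k + 1 > 0"
  shows "a gchoose k = Gamma (a + 1) / (fact k * Gamma (a - real k + 1))"
proof -
  have "a - real k + 1 \<notin> \<int>\<^sub>\<le>\<^sub>0"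
    using assms by (auto elim!: nonpos_Ints_cases)
  then show ?thesis
    by (simp add: gbinomial_pochhammer' pochhammer_Gamma)
qed

text \<open>Pascal's rule turns the sum for \<open>Suc n\<close> at \<open>z\<close> into the sum
  for \<open>n\<close> at \<open>z\<close> minus the sum for \<open>n\<close> at
  \<open>z + 1\<close>, so the induction runs over all \<open>z\<close> at once. The identity is the
  partial fraction expansion of the right-hand side in \<open>z\<close>.\<close>

lemma sum_alternating_binomial_reciprocal:
  fixes z :: real
  assumes "z > 0"
  shows "(\<Sum>k\<le>n. (-1) ^ k * real (n choose k) / (z + real k)) = fact n / pochhammer z (Suc n)"
  using assms
proof (induction n arbitrary: z)
  case 0
  then show ?case by simp
next
  case (Suc n)
  have "(\<Sum>k\<le>Suc n. (-1) ^ k * real (Suc n choose k) / (z + real k)) =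
      1 / z + (\<Sum>k\<le>n. (-1) ^ Suc k * real (Suc n choose Suc k) / (z + real (Suc k)))"
    by (subst sum.atMost_Suc_shift) simp
  also have "\<dots> = (1 / z + (\<Sum>k\<le>n. (-1) ^ Suc k * real (n choose Suc k) / (z + real (Suc k))))
      - (\<Sum>k\<le>n. (-1) ^ k * real (n choose k) / (z + 1 + real k))"
    by (simp add: sum.distrib [symmetric] sum_negf [symmetric] add_divide_distrib diff_divide_distrib
        ring_distribs add_ac)
  also have "1 / z + (\<Sum>k\<le>n. (-1) ^ Suc k * real (n choose Suc k) / (z + real (Suc k))) =
      (\<Sum>k\<le>Suc n. (-1) ^ k * real (n choose k) / (z + real k))"
    by (subst sum.atMost_Suc_shift) simp
  also have "\<dots> = (\<Sum>k\<le>n. (-1) ^ k * real (n choose k) / (z + real k))"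
    by simp
  finally have "(\<Sum>k\<le>Suc n. (-1) ^ k * real (Suc n choose k) / (z + real k)) =
      fact n / pochhammer z (Suc n) - fact n / pochhammer (z + 1) (Suc n)"
    using Suc.IH [of z] Suc.IH [of "z + 1"] Suc.prems by simp
  also have "\<dots> = fact n / (z * pochhammer (z + 1) n) - fact n / (pochhammer (z + 1) n * (z + 1 + n))"
    by (simp add: pochhammer_rec [of z] pochhammer_Suc [of "z + 1"])
  also have "\<dots> = fact (Suc n) / (z * (pochhammer (z + 1) n * (z + 1 + n)))"
  proof -
    have "f / (z * p) - f / (p * (z + 1 + n)) = real (Suc n) * f / (z * (p * (z + 1 + n)))"
      if "p > 0" for f p :: real
      using that Suc.prems by (simp add: divide_simps) (simp add: algebra_simps)
    from this [OF pochhammer_pos, of "z + 1" "fact n" n] Suc.prems show ?thesis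
      by simp
  qed
  also have "\<dots> = fact (Suc n) / pochhammer z (Suc (Suc n))"
    by (simp only: pochhammer_rec [of z] pochhammer_Suc [of "z + 1"])
  finally show ?case .
qed

section \<open>Integrals against the Jacobi weight\<close>

lemma jacobi_weight_has_integral:
  fixes a c :: real
  assumes "a > -1" and "c > -1"
  shows "((\<lambda>t. (1 - t) powr a * (1 + t) powr c) has_integral
           2 powr (a + c + 1) * Beta (a + 1) (c + 1)) {-1..1}"
proof -
  have "((\<lambda>t. t powr c * (1 - t) powr a) has_integral Beta (a + 1) (c + 1)) {0..1}"
    using has_integral_Beta_real [of "c + 1" "a + 1"] assms by (simp add: Beta_commute)
  then have "((\<lambda>t. (1/2 * t + 1/2) powr c * (1 - (1/2 * t + 1/2)) powr a) has_integral
      2 * Beta (a + 1) (c + 1)) {-1..1}"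
    using has_integral_affinity' [of "\<lambda>t. t powr c * (1 - t) powr a" _ 0 1 "1/2" "1/2"] by simp
  \<comment> \<open>\<open>1 + t\<close> and \<open>1 - t\<close> are twice the two affine
    arguments, so this factor clears the halves under the powers.\<close>
  then have "((\<lambda>t. 2 powr (a + c) * ((1/2 * t + 1/2) powr c * (1 - (1/2 * t + 1/2)) powr a))
      has_integral 2 powr (a + c) * (2 * Beta (a + 1) (c + 1))) {-1..1}"
    by (rule has_integral_mult_right)
  moreover have "2 powr (a + c) * ((1/2 * t + 1/2) powr c * (1 - (1/2 * t + 1/2)) powr a) =
      (1 - t) powr a * (1 + t) powr c" if "t \<in> {-1..1}" for t :: real
  proof -
    have "1/2 * t + 1/2 = (1 + t) / 2" "1 - (1/2 * t + 1/2) = (1 - t) / 2"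
      by (simp_all add: field_simps)
    then show ?thesis
      using that by (simp only: powr_divide powr_add) simp
  qed
  ultimately have "((\<lambda>t. (1 - t) powr a * (1 + t) powr c) has_integral
      2 powr (a + c) * (2 * Beta (a + 1) (c + 1))) {-1..1}"
    by (rule has_integral_eq [rotated])
  then show ?thesis
    by (simp add: powr_add mult_ac)
qed

lemma jacobi_weight_pearson:
  fixes a c :: real and y :: "real poly"
  assumes "a > -1" and "c > -1"
  shows "((\<lambda>t. (1 - t) powr a * (1 + t) powr c *
            poly ([:1, 0, -1:] * pderiv y + [:c - a, -(a + c + 2):] * y) t) has_integral 0) {-1..1}"
proof -
  let ?F = "\<lambda>t. (1 - t) powr (a + 1) * (1 + t) powr (c + 1) * poly y t"
  let ?f = "\<lambda>t. (1 - t) powr a * (1 + t) powr c *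
            poly ([:1, 0, -1:] * pderiv y + [:c - a, -(a + c + 2):] * y) t"
  have "(?f has_integral (?F 1 - ?F (-1))) {-1..1}"
  \<comment> \<open>The exponents \<open>a + 1\<close> and \<open>c + 1\<close> are positive, so
    \<open>?F\<close> is continuous up to the endpoints and vanishes there, even where the weight
    itself is unbounded. Differentiation takes place in the open interval only.\<close>
  proof (rule fundamental_theorem_of_calculus_interior)
    show "continuous_on {-1..1} ?F"
      using assms by (intro continuous_on_mult continuous_on_powr' continuous_on_diff continuous_on_add
          continuous_on_const continuous_on_id continuous_on_poly) auto
    fix t :: real
    assume t: "t \<in> {-1<..<1}"
    have powr: "((\<lambda>s. s powr (r + 1)) has_real_derivative (r + 1) * s powr r) (at s)"
      if "s > 0" for r s :: real
      using has_real_derivative_powr [OF that, of "r + 1"] by simp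
    have "((\<lambda>t. (1 - t) powr (a + 1)) has_real_derivative (a + 1) * (1 - t) powr a * (-1)) (at t)"
      using t by (intro DERIV_chain2 [OF powr]) (auto intro!: derivative_eq_intros)
    moreover have "((\<lambda>t. (1 + t) powr (c + 1)) has_real_derivative (c + 1) * (1 + t) powr c * 1) (at t)"
      using t by (intro DERIV_chain2 [OF powr]) (auto intro!: derivative_eq_intros)
    ultimately have "(?F has_real_derivative
        ((a + 1) * (1 - t) powr a * (-1) * (1 + t) powr (c + 1) +
         (c + 1) * (1 + t) powr c * 1 * (1 - t) powr (a + 1)) * poly y t +
        poly (pderiv y) t * ((1 - t) powr (a + 1) * (1 + t) powr (c + 1))) (at t)"
      by (intro DERIV_mult poly_DERIV)
    then have "(?F has_real_derivative ?f t) (at t)"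
      by (rule DERIV_cong) (use t in \<open>simp add: powr_add algebra_simps\<close>)
    then show "(?F has_vector_derivative ?f t) (at t)"
      by (simp add: has_real_derivative_iff_has_vector_derivative)
  qed simp
  then show ?thesis by simp
qed

section \<open>Coefficients and values of Jacobi polynomials\<close>

lemma degree_jacobi_poly_le: "degree (jacobi_poly m a b) \<le> m"
  unfolding jacobi_poly_def
proof (rule degree_sum_le)
  fix k assume "k \<in> {..m}"
  then show "degree (smult ((real m + a gchoose (m - k)) * (real m + b gchoose k))
      ([:- 1 / 2, 1 / 2:] ^ k * [:1 / 2, 1 / 2:] ^ (m - k))) \<le> m"
    by (intro order_trans [OF degree_smult_le] order_trans [OF degree_mult_le])
      (auto simp: degree_power_eq)
qed simp

text \<open>Both linear factors have leading coefficient 1/2, so every product of \<open>m\<close>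
  of them contributes the same \<open>1 / 2 ^ m\<close>, and Vandermonde's identity sums the
  binomial products.\<close>

lemma coeff_jacobi_poly:
  "coeff (jacobi_poly m a b) m = (2 * real m + a + b gchoose m) / 2 ^ m"
proof -
  have "coeff ([:-1/2, 1/2:] ^ k * [:1/2, 1/2:] ^ (m - k)) m = 1 / (2::real) ^ m" if "k \<le> m" for k
  proof -
    have "coeff ([:-1/2, 1/2:] ^ k * [:1/2, 1/2:] ^ (m - k)) (k + (m - k)) = (1/2::real) ^ k * (1/2) ^ (m - k)"
      using coeff_mult_degree_sum [of "[:-1/2, 1/2::real:] ^ k" "[:1/2, 1/2:] ^ (m - k)"]
        lead_coeff_power [of "[:-1/2, 1/2::real:]" k] lead_coeff_power [of "[:1/2, 1/2::real:]" "m - k"]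
      by (simp add: degree_power_eq)
    then show ?thesis
      using that by (simp add: power_add [symmetric] power_one_over)
  qed
  then have "coeff (jacobi_poly m a b) m =
      (\<Sum>k\<le>m. (real m + a gchoose (m - k)) * (real m + b gchoose k)) / 2 ^ m"
    by (simp add: jacobi_poly_def coeff_sum sum_divide_distrib)
  also have "(\<Sum>k\<le>m. (real m + a gchoose (m - k)) * (real m + b gchoose k)) = (2 * real m + a + b gchoose m)"
    using gbinomial_Vandermonde [of "real m + b" "real m + a" m]
    by (simp add: atLeast0AtMost algebra_simps)
  finally show ?thesis .
qed

lemma poly_jacobi_poly_minus_one:
  "poly (jacobi_poly m a b) (-1) = (-1) ^ m * (real m + b gchoose m)"
proof -
  \<comment> \<open>The factor \<open>(1 + t) / 2\<close> vanishes at -1 and kills every summand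
    except \<open>k = m\<close>, where its exponent is 0.\<close>
  have "poly (jacobi_poly m a b) (-1) =
      (\<Sum>k\<le>m. if k = m then (-1) ^ m * (real m + b gchoose m) else 0)"
    unfolding jacobi_poly_def poly_sum by (intro sum.cong) (auto simp: power_0_left)
  then show ?thesis by simp
qed

text \<open>Both final formulas arise this way: \<open>q\<close> is a product of node differences
  with known sign \<open>s\<close>, \<open>d\<close> is the absolute value of the constant, and
  \<open>u\<close> is the quantity under the root.\<close>

lemma inverse_eq_signed_sqrt:
  fixes s q d u :: real
  assumes "\<bar>s\<bar> = 1" "s * q > 0" "d \<ge> 0" "d\<^sup>2 * u * q\<^sup>2 = 1"
  shows "inverse q = s * d * sqrt u"
proof -
  have "(inverse q)\<^sup>2 = d\<^sup>2 * u"
    unfolding power_inverse using assms(4) by (intro inverse_unique) (simp only: mult.commute)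
  then have "\<bar>inverse q\<bar> = sqrt (d\<^sup>2 * u)"
    by (metis real_sqrt_abs)
  also have "\<dots> = d * sqrt u"
    using assms(3) by (metis real_sqrt_mult real_sqrt_abs abs_of_nonneg)
  finally have "\<bar>inverse q\<bar> = d * sqrt u" .
  moreover have "inverse q = s * \<bar>inverse q\<bar>"
    using assms(1,2) by (cases "s = 1") (auto simp: abs_if split: if_splits)
  ultimately show ?thesis
    by (simp only: mult.assoc)
qed

section \<open>Consequences of exactness at the nodes\<close>

lemma gauss_jacobi_radau_rule_unique:
  assumes "gauss_jacobi_radau_rule \<alpha> \<beta> n x v w" and "degree p \<le> 2 * n + 2"
    and "((\<lambda>t. (1 - t) powr \<alpha> * (1 + t) powr \<beta> * poly p t) has_integral I) {-1..1}"
  shows "v * poly p (-1) + (\<Sum>j\<le>n. w j * poly p (x j)) = I"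
  using assms has_integral_unique unfolding gauss_jacobi_radau_rule_def by blast

text \<open>This is \<open>q / (t - x j)\<close> for the monic \<open>q\<close> with roots
  \<open>x 0\<close>, ..., \<open>x n\<close>: an unnormalised Lagrange basis polynomial.\<close>

definition cofactor :: "nat \<Rightarrow> (nat \<Rightarrow> real) \<Rightarrow> nat \<Rightarrow> real poly" where
  "cofactor n x j = (\<Prod>i\<in>{..n} - {j}. [:- x i, 1:])"

lemma poly_cofactor: "poly (cofactor n x j) t = (\<Prod>i\<in>{..n} - {j}. t - x i)"
  by (simp add: cofactor_def poly_prod)

lemma poly_cofactor_node: "i \<le> n \<Longrightarrow> i \<noteq> j \<Longrightarrow> poly (cofactor n x j) (x i) = 0"
  by (auto simp: poly_cofactor)

lemma degree_cofactor: "j \<le> n \<Longrightarrow> degree (cofactor n x j) = n"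
  unfolding cofactor_def by (subst degree_prod_eq_sum_degree) auto

lemma gauss_jacobi_radau_weight_relation:
  fixes \<alpha> \<beta> :: real
  assumes "\<alpha> > -1" "\<beta> > -1" and rule: "gauss_jacobi_radau_rule \<alpha> \<beta> n x v w" and j: "j \<le> n"
  shows "w j * (1 - (x j)\<^sup>2) * (poly (cofactor n x j) (x j))\<^sup>2 =
     2 * (\<beta> + 1) * v * (1 + x j) * (poly (cofactor n x j) (-1))\<^sup>2"
proof -
  let ?g = "cofactor n x j"
  let ?y = "[:- x j, 1:] * ?g\<^sup>2"
  let ?p = "[:1, 0, -1:] * pderiv ?y + [:\<beta> - \<alpha>, -(\<alpha> + \<beta> + 2):] * ?y"
  have dy: "degree ?y \<le> 2 * n + 1"
    using j by (intro order_trans [OF degree_mult_le])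
      (auto intro!: order_trans [OF degree_power_le] simp: degree_cofactor)
  have "degree ?p \<le> 2 * n + 2"
  proof (intro degree_add_le)
    show "degree ([:1, 0, -1:] * pderiv ?y) \<le> 2 * n + 2"
      using dy degree_pderiv [of ?y] by (intro order_trans [OF degree_mult_le]) simp
    show "degree ([:\<beta> - \<alpha>, -(\<alpha> + \<beta> + 2):] * ?y) \<le> 2 * n + 2"
      using dy by (intro order_trans [OF degree_mult_le])
        (simp add: order_trans [OF add_mono [OF degree_pCons_le dy]])
  qed
  then have "v * poly ?p (-1) + (\<Sum>i\<le>n. w i * poly ?p (x i)) = 0"
    using gauss_jacobi_radau_rule_unique [OF rule _ jacobi_weight_pearson] assms(1,2) by blast
  also have "(\<Sum>i\<le>n. w i * poly ?p (x i)) =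
      (\<Sum>i\<le>n. if i = j then w j * ((1 - (x j)\<^sup>2) * (poly ?g (x j))\<^sup>2) else 0)"
  proof (intro sum.cong refl)
    fix i assume "i \<in> {..n}"
    \<comment> \<open>\<open>?y\<close> has a simple zero at \<open>x j\<close> and double zeros at
      the other nodes, so its derivative agrees with \<open>?g\<^sup>2\<close> at all of
      them.\<close>
    then have "poly (pderiv ?y) (x i) = (poly ?g (x i))\<^sup>2" "poly ?y (x i) = 0"
      by (cases "i = j"; simp only: pderiv_mult power2_eq_square pderiv_pCons;
        simp add: poly_cofactor_node)+
    then show "w i * poly ?p (x i) =
        (if i = j then w j * ((1 - (x j)\<^sup>2) * (poly ?g (x j))\<^sup>2) else 0)"
      using \<open>i \<in> {..n}\<close>
      by (simp only: poly_add poly_mult, auto simp: poly_cofactor_node power2_eq_square algebra_simps)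
  qed
  also have "\<dots> = w j * ((1 - (x j)\<^sup>2) * (poly ?g (x j))\<^sup>2)"
    using j by simp
  \<comment> \<open>At -1 the factor \<open>1 - t\<^sup>2\<close> removes the derivative, and the
    linear factor takes the value \<open>2 * (\<beta> + 1)\<close>.\<close>
  also have "poly ?p (-1) = - 2 * (\<beta> + 1) * (1 + x j) * (poly ?g (-1))\<^sup>2"
    by (simp add: power2_eq_square algebra_simps)
  finally show ?thesis
    by (simp add: algebra_simps)
qed

text \<open>The factor \<open>1 + t\<close> removes the node -1 and the squared cofactor removes
  every other node but \<open>x j\<close>, while the integrand stays nonnegative. The factor
  \<open>1 + x j\<close> remains because its sign is still unknown.\<close>

lemma gauss_jacobi_radau_weight_nonneg:
  assumes rule: "gauss_jacobi_radau_rule \<alpha> \<beta> n x v w" and j: "j \<le> n"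
  shows "w j * (1 + x j) * (poly (cofactor n x j) (x j))\<^sup>2 \<ge> 0"
proof -
  let ?g = "cofactor n x j"
  let ?p = "[:1, 1:] * ?g\<^sup>2"
  have "degree ?p \<le> 2 * n + 2"
    using j by (intro order_trans [OF degree_mult_le])
      (auto intro!: order_trans [OF degree_power_le] simp: degree_cofactor)
  then have "((\<lambda>t. (1 - t) powr \<alpha> * (1 + t) powr \<beta> * poly ?p t) has_integral
      (v * poly ?p (-1) + (\<Sum>i\<le>n. w i * poly ?p (x i)))) {-1..1}"
    using rule unfolding gauss_jacobi_radau_rule_def by blast
  then have "v * poly ?p (-1) + (\<Sum>i\<le>n. w i * poly ?p (x i)) \<ge> 0"
    by (rule has_integral_nonneg) (simp only: poly_mult poly_power, auto)
  also have "(\<Sum>i\<le>n. w i * poly ?p (x i)) =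
      (\<Sum>i\<le>n. if i = j then w j * (1 + x j) * (poly ?g (x j))\<^sup>2 else 0)"
    by (intro sum.cong refl) (auto simp: poly_cofactor_node algebra_simps)
  finally show ?thesis
    using j by simp
qed

section \<open>Linear factors, the constant, and signs of node products\<close>

lemma jacobi_poly_eq_smult_prod:
  assumes inj: "inj_on x {..n}" and roots: "x ` {..n} = {r. poly (jacobi_poly (n + 1) a b) r = 0}"
  shows "jacobi_poly (n + 1) a b =
    smult (coeff (jacobi_poly (n + 1) a b) (n + 1)) (\<Prod>i\<le>n. [:- x i, 1:])"
proof -
  let ?q = "\<Prod>i\<le>n. [:- x i, 1:]"
  have deg: "degree ?q = n + 1"
    by (subst degree_prod_eq_sum_degree) auto
  have "lead_coeff ?q = 1"
    by (simp add: lead_coeff_prod)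
  then have "coeff ?q (n + 1) = 1"
    by (simp only: deg)
  then show ?thesis
  \<comment> \<open>Both sides have degree at most \<open>n + 1\<close> and the same coefficient
    there, so their difference has degree at most \<open>n\<close>; it vanishes at
    \<open>n + 1\<close> distinct points.\<close>
  proof (intro poly_eqI_degree_lead_coeff [of _ "n + 1" _ "x ` {..n}"])
    fix z assume z: "z \<in> x ` {..n}"
    then have "poly ?q z = 0"
      by (auto simp: poly_prod)
    with z roots show "poly (jacobi_poly (n + 1) a b) z =
        poly (smult (coeff (jacobi_poly (n + 1) a b) (n + 1)) ?q) z"
      by auto
  qed (use inj deg degree_jacobi_poly_le degree_smult_le [of _ ?q] in \<open>auto simp: card_image\<close>)
qed

text \<open>All factors after the initial sign are nonnegative. Sign and magnitude of the
  barycentric weights can thus be found separately.\<close>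

lemma jacobi_const_sgn_abs:
  assumes "a > -1" "b > 0"
  shows "jacobi_const n a b = (-1) ^ n * \<bar>jacobi_const n a b\<bar>"
proof -
  let ?d = "Gamma (2 * real n + a + b + 3) / 2 powr (real n + 1 + (a + b + 1) / 2) *
     (1 / sqrt (fact (n + 1) * Gamma (real n + a + b + 2) * Gamma (real n + a + 2) * Gamma (real n + b + 2)))"
  have "(if even n then 1 else -1) = (-1 :: real) ^ n"
    by (rule minus_one_power_iff [symmetric])
  then have eq: "jacobi_const n a b = (-1) ^ n * ?d"
    unfolding jacobi_const_def by (simp only: mult.assoc)
  have "?d \<ge> 0"
    using assms by (intro mult_nonneg_nonneg divide_nonneg_nonneg real_sqrt_ge_zero Gamma_real_nonneg) auto
  moreover have "c = (-1) ^ n * \<bar>c\<bar>" if "c = (-1) ^ n * d" "d \<ge> 0" for c d :: real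
    using that by (simp add: abs_mult power_abs)
  ultimately show ?thesis
    using eq by blast
qed

lemma jacobi_const_square:
  assumes "a > -1" "b > 0"
  shows "(jacobi_const n a b)\<^sup>2 = (Gamma (2 * real n + a + b + 3))\<^sup>2 /
    (4 ^ (n + 1) * 2 powr (a + b + 1) * fact (n + 1) * Gamma (real n + a + b + 2) *
      Gamma (real n + a + 2) * Gamma (real n + b + 2))"
proof -
  \<comment> \<open>Squaring doubles the exponent of 2: \<open>n + 1\<close> gives
    \<open>4 ^ (n + 1)\<close>, and the half \<open>(a + b + 1) / 2\<close> becomes
    \<open>a + b + 1\<close>.\<close>
  have "real 2 * (real n + 1 + (a + b + 1) / 2) = 2 * (real n + 1) + (a + b + 1)"
    by simp
  then have "(2 powr (real n + 1 + (a + b + 1) / 2))\<^sup>2 = 2 powr (2 * (real n + 1) + (a + b + 1))"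
    by (simp only: powr_power mult.commute [of _ "real 2"])
  also have "\<dots> = (2 powr 2) powr (real (n + 1)) * 2 powr (a + b + 1)"
    by (simp only: powr_add powr_powr) (simp add: powr_add)
  also have "\<dots> = 4 ^ (n + 1) * 2 powr (a + b + 1)"
    by (simp add: powr_realpow powr_add)
  finally have 1: "(2 powr (real n + 1 + (a + b + 1) / 2))\<^sup>2 = 4 ^ (n + 1) * 2 powr (a + b + 1)" .
  have 2: "fact (n + 1) * Gamma (real n + a + b + 2) * Gamma (real n + a + 2) * Gamma (real n + b + 2) \<ge> 0"
    using assms by (intro mult_nonneg_nonneg) auto
  have 3: "(if even n then 1 else -1 :: real)\<^sup>2 = 1"
    by simp
  show ?thesis
    unfolding jacobi_const_def power_mult_distrib power_divide 1 3 real_sqrt_pow2 [OF 2]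
    by (simp add: mult_ac)
qed

text \<open>Exactly the \<open>n - j\<close> factors with \<open>i > j\<close> are negative. The
  sign is split as \<open>(-1) ^ n * (-1) ^ j\<close> since \<open>(-1) ^ n\<close> belongs to the
  constant and \<open>(-1) ^ j\<close> is explicit in the theorem.\<close>

lemma prod_node_differences_sign:
  fixes x :: "nat \<Rightarrow> real"
  assumes mono: "strict_mono_on {..n} x" and j: "j \<le> n"
  shows "(-1) ^ n * (-1) ^ j * (\<Prod>i\<in>{..n} - {j}. x j - x i) > 0"
proof -
  have split: "{..n} - {j} = {..<j} \<union> {j<..n}" using j by auto
  have "(\<Prod>i\<in>{..n} - {j}. x j - x i) = (\<Prod>i<j. x j - x i) * (\<Prod>i\<in>{j<..n}. x j - x i)"
    unfolding split by (rule prod.union_disjoint) auto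
  also have "(\<Prod>i\<in>{j<..n}. x j - x i) = (\<Prod>i\<in>{j<..n}. - 1 * (x i - x j))"
    by simp
  also have "(\<Prod>i\<in>{j<..n}. - 1 * (x i - x j)) = (-1) ^ (n - j) * (\<Prod>i\<in>{j<..n}. x i - x j)"
    by (simp only: prod.distrib prod_constant card_greaterThanAtMost)
  finally have "(-1) ^ n * (-1) ^ j * (\<Prod>i\<in>{..n} - {j}. x j - x i) =
      ((-1) ^ n * (-1) ^ j * (-1) ^ (n - j)) * ((\<Prod>i<j. x j - x i) * (\<Prod>i\<in>{j<..n}. x i - x j))"
    by (simp add: mult_ac)
  also have "(-1) ^ n * (-1) ^ j * (-1) ^ (n - j) = (1::real)"
    using j by (auto simp: minus_one_power_iff)
  finally have "(-1) ^ n * (-1) ^ j * (\<Prod>i\<in>{..n} - {j}. x j - x i) =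
      (\<Prod>i<j. x j - x i) * (\<Prod>i\<in>{j<..n}. x i - x j)"
    by (simp only: mult_1)
  moreover have "(\<Prod>i<j. x j - x i) > 0"
    using j strict_mono_onD [OF mono, of _ j] by (intro prod_pos) simp
  moreover have "(\<Prod>i\<in>{j<..n}. x i - x j) > 0"
    using j strict_mono_onD [OF mono, of j] by (intro prod_pos) simp
  ultimately show ?thesis
    by (simp only: mult_pos_pos)
qed

section \<open>Location of the nodes and barycentric products\<close>

lemma gauss_jacobi_radau_node:
  fixes \<alpha> \<beta> v :: real
  assumes "\<alpha> > -1" "\<beta> > -1" and v: "v > 0" and mono: "strict_mono_on {..n} x"
    and rule: "gauss_jacobi_radau_rule \<alpha> \<beta> n x v w" and j: "j \<le> n"
    and q: "(\<Prod>i\<le>n. -1 - x i) \<noteq> 0"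
  shows "x j > -1"
    and "w j * (1 - x j) * ((1 + x j) * (\<Prod>i\<in>{..n} - {j}. x j - x i))\<^sup>2 =
      2 * (\<beta> + 1) * v * (\<Prod>i\<le>n. -1 - x i)\<^sup>2"
proof -
  let ?q = "\<Prod>i\<le>n. -1 - x i"
  let ?d = "\<Prod>i\<in>{..n} - {j}. x j - x i" and ?e = "\<Prod>i\<in>{..n} - {j}. -1 - x i"
  have q_eq: "?q = (-1 - x j) * ?e"
    using j by (subst prod.remove [of _ j]) auto
  have "1 + x j \<noteq> 0"
    using q unfolding q_eq by auto
  moreover have "?d \<noteq> 0"
    using prod_node_differences_sign [OF mono j] by (metis less_irrefl mult_zero_right)
  ultimately have ne: "1 + x j \<noteq> 0" "?d \<noteq> 0" .
  have "w j * (1 - (x j)\<^sup>2) * ?d\<^sup>2 = 2 * (\<beta> + 1) * v * (1 + x j) * ?e\<^sup>2"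
    using gauss_jacobi_radau_weight_relation [OF assms(1,2) rule j] by (simp add: poly_cofactor)
  \<comment> \<open>Multiplying the weight relation by \<open>1 + X\<close> completes both squares:
    \<open>(1 + X) * D\<close> is the barycentric denominator of \<open>x j\<close>, and
    \<open>(-1 - X) * E\<close> is the full product at -1.\<close>
  moreover have "W * (1 - X) * ((1 + X) * D)\<^sup>2 = B * ((-1 - X) * E)\<^sup>2"
    if "W * (1 - X\<^sup>2) * D\<^sup>2 = B * (1 + X) * E\<^sup>2" for W X D B E :: real
    using that by algebra
  ultimately have rel: "w j * (1 - x j) * ((1 + x j) * ?d)\<^sup>2 = 2 * (\<beta> + 1) * v * ?q\<^sup>2"
    unfolding q_eq by blast
  have "2 * (\<beta> + 1) * v * ?q\<^sup>2 > 0"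
    using assms(2) v q by simp
  with rel have "w j * (1 - x j) * ((1 + x j) * ?d)\<^sup>2 > 0" by simp
  moreover have "((1 + x j) * ?d)\<^sup>2 > 0" using ne by simp
  ultimately have pos: "w j * (1 - x j) > 0"
    by (rule zero_less_mult_pos2)
  have "?d\<^sup>2 > 0" using ne by simp
  then have "w j * (1 + x j) \<ge> 0"
    using gauss_jacobi_radau_weight_nonneg [OF rule j]
    by (simp add: poly_cofactor zero_le_mult_iff)
  \<comment> \<open>Left of -1 the factor \<open>1 - x j\<close> is positive, so \<open>pos\<close>
    forces \<open>w j > 0\<close>, contradicting the nonnegativity just shown. The case
    \<open>x j = -1\<close> is excluded by \<open>ne\<close>.\<close>
  moreover have "w j * (1 + x j) < 0" if "x j < -1"
  proof (rule mult_pos_neg)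
    show "w j > 0"
      using pos that zero_less_mult_pos2 [of "w j" "1 - x j"] by linarith
  qed (use that in simp)
  ultimately have "x j > -1"
    using ne(1) by linarith
  with rel show "x j > -1"
    and "w j * (1 - x j) * ((1 + x j) * (\<Prod>i\<in>{..n} - {j}. x j - x i))\<^sup>2 =
      2 * (\<beta> + 1) * v * (\<Prod>i\<le>n. -1 - x i)\<^sup>2"
    by blast+
qed

lemma barycentric_weight_insert:
  assumes "finite I" "c \<notin> x ` I"
  shows barycentric_weight_insert_new:
      "inj_on x I \<Longrightarrow> barycentric_weight (insert c (x ` I)) c = inverse (\<Prod>i\<in>I. c - x i)"
    and barycentric_weight_insert_image:
      "inj_on x I \<Longrightarrow> j \<in> I \<Longrightarrow> barycentric_weight (insert c (x ` I)) (x j) =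
         inverse ((x j - c) * (\<Prod>i\<in>I - {j}. x j - x i))"
proof -
  assume inj: "inj_on x I"
  show "barycentric_weight (insert c (x ` I)) c = inverse (\<Prod>i\<in>I. c - x i)"
    using assms inj by (simp add: barycentric_weight_def prod.reindex prod_inversef [symmetric])
next
  assume inj: "inj_on x I" and j: "j \<in> I"
  have "insert c (x ` I) - {x j} = insert c (x ` (I - {j}))"
    using inj j assms by (auto simp: inj_on_def)
  moreover have "(\<Prod>y\<in>x ` (I - {j}). inverse (x j - y)) = inverse (\<Prod>i\<in>I - {j}. x j - x i)"
    using inj by (subst prod.reindex) (auto intro: inj_on_subset simp: prod_inversef [symmetric])
  moreover have "c \<notin> x ` (I - {j})" "finite (x ` (I - {j}))"
    using assms by auto
  ultimately show "barycentric_weight (insert c (x ` I)) (x j) =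
      inverse ((x j - c) * (\<Prod>i\<in>I - {j}. x j - x i))"
    by (simp add: barycentric_weight_def)
qed

text \<open>All \<open>n + 1\<close> factors are negative; writing the sign as
  \<open>- ((-1) ^ n)\<close> matches the minus sign in front of the constant.\<close>

lemma prod_left_endpoint_sign:
  fixes x :: "nat \<Rightarrow> real"
  assumes "\<And>i. i \<le> n \<Longrightarrow> x i > c"
  shows "- ((-1) ^ n) * (\<Prod>i\<le>n. c - x i) > 0"
proof -
  have "(\<Prod>i\<le>n. c - x i) = (\<Prod>i\<le>n. -1 * (x i - c))" by simp
  also have "\<dots> = (-1) ^ (n + 1) * (\<Prod>i\<le>n. x i - c)"
    by (simp only: prod.distrib prod_constant card_atMost) simp
  finally have "- ((-1) ^ n) * (\<Prod>i\<le>n. c - x i) = (\<Prod>i\<le>n. x i - c)" by simp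
  also have "\<dots> > 0"
    using assms by (intro prod_pos) auto
  finally show ?thesis .
qed

section \<open>The integral of the Jacobi polynomial and the weight at -1\<close>

text \<open>The weight carries \<open>b - 1\<close> while the polynomial carries \<open>b\<close>,
  so orthogonality does not make the integral vanish. Expanded termwise it is a sum of Beta
  integrals whose Gamma factors depending on \<open>k\<close> combine to a binomial coefficient over
  \<open>b + real (m - k)\<close>, leaving the partial fraction sum.\<close>

lemma jacobi_poly_has_integral:
  fixes a b :: real
  assumes "a > -1" and "b > 0"
  shows "((\<lambda>t. (1 - t) powr a * (1 + t) powr (b - 1) * poly (jacobi_poly m a b) t) has_integral
     (-1) ^ m * 2 powr (a + b) * Gamma (real m + a + 1) * Gamma b / Gamma (real m + a + b + 1)) {-1..1}"
proof -
  let ?c = "\<lambda>k. (real m + a gchoose (m - k)) * (real m + b gchoose k) * ((-1) ^ k / 2 ^ m)"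
  have eq: "(1 - t) powr a * (1 + t) powr (b - 1) * poly (jacobi_poly m a b) t =
     (\<Sum>k\<le>m. ?c k * ((1 - t) powr (a + real k) * (1 + t) powr (b - 1 + real (m - k))))"
    if t: "t \<in> {-1..1}" for t
  proof -
    \<comment> \<open>At \<open>s = 0\<close> both sides are 0, since \<open>0 powr c = 0\<close>
      for every \<open>c\<close>; the identity therefore covers the endpoints.\<close>
    have pw: "s powr c * s ^ i = s powr (c + real i)" if "s \<ge> 0" for s c :: real and i
      using that by (cases "s = 0") (auto simp: powr_add powr_realpow)
    have "(1 - t) powr a * (1 + t) powr (b - 1) * ((-1/2 + t * (1/2)) ^ k * (1/2 + t * (1/2)) ^ (m - k)) =
        (-1) ^ k / 2 ^ m * ((1 - t) powr (a + real k) * (1 + t) powr (b - 1 + real (m - k)))"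
      if "k \<le> m" for k
    proof -
      have "-1/2 + t * (1/2) = -1 * (1 - t) / 2" "1/2 + t * (1/2) = (1 + t) / 2"
        by (simp_all add: field_simps)
      then have "(-1/2 + t * (1/2)) ^ k * (1/2 + t * (1/2)) ^ (m - k) =
          (-1) ^ k / (2 ^ k * 2 ^ (m - k)) * ((1 - t) ^ k * (1 + t) ^ (m - k))"
        by (simp only: power_divide power_mult_distrib) simp
      also have "(2::real) ^ k * 2 ^ (m - k) = 2 ^ m"
        using that by (simp add: power_add [symmetric])
      finally show ?thesis
        using t by (simp add: pw [symmetric] mult_ac)
    qed
    then show ?thesis
      unfolding jacobi_poly_def poly_sum sum_distrib_left
      by (intro sum.cong refl) (simp add: mult_ac)
  qed
  have "((\<lambda>t. \<Sum>k\<le>m. ?c k * ((1 - t) powr (a + real k) * (1 + t) powr (b - 1 + real (m - k))))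
     has_integral (\<Sum>k\<le>m. ?c k * (2 powr (a + real k + (b - 1 + real (m - k)) + 1) *
        Beta (a + real k + 1) (b - 1 + real (m - k) + 1)))) {-1..1}"
    using assms by (intro has_integral_sum has_integral_mult_right jacobi_weight_has_integral) auto
  also have "(\<Sum>k\<le>m. ?c k * (2 powr (a + real k + (b - 1 + real (m - k)) + 1) *
        Beta (a + real k + 1) (b - 1 + real (m - k) + 1))) =
     (\<Sum>k\<le>m. 2 powr (a + b) * Gamma (real m + a + 1) * Gamma (real m + b + 1) /
        (Gamma (real m + a + b + 1) * fact m) *
        ((-1) ^ k * real (m choose k) / (b + real (m - k))))"
  proof (intro sum.cong refl)
    fix k assume "k \<in> {..m}"
    then have k: "k \<le> m" by simp
    have 1: "real m + a gchoose (m - k) =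
        Gamma (real m + a + 1) / (fact (m - k) * Gamma (a + real k + 1))"
      using k assms by (subst gbinomial_Gamma) (auto simp: algebra_simps)
    have 2: "real m + b gchoose k =
        Gamma (real m + b + 1) / (fact k * Gamma (b + real (m - k) + 1))"
      using k assms by (subst gbinomial_Gamma) (auto simp: algebra_simps)
    \<comment> \<open>This shift by one leaves the factor \<open>b + real (m - k)\<close> in the
      denominator after the Gamma values cancel.\<close>
    have 3: "Gamma (b + real (m - k) + 1) = (b + real (m - k)) * Gamma (b + real (m - k))"
      using assms by (intro Gamma_plus1) (auto elim!: nonpos_Ints_cases)
    have 4: "2 powr (a + real k + (b - 1 + real (m - k)) + 1) = 2 powr (a + b) * 2 ^ m"
    proof -
      have "a + real k + (b - 1 + real (m - k)) + 1 = a + b + real m"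
        using k by simp
      then show ?thesis by (simp add: powr_add powr_realpow)
    qed
    have 5: "Beta (a + real k + 1) (b - 1 + real (m - k) + 1) =
        Gamma (a + real k + 1) * Gamma (b + real (m - k)) / Gamma (real m + a + b + 1)"
      using k by (simp add: Beta_def algebra_simps)
    have pos: "Gamma (a + real k + 1) > 0" "Gamma (b + real (m - k)) > 0" "b + real (m - k) > 0"
      "Gamma (real m + a + b + 1) > 0"
      using assms k by (auto intro!: Gamma_real_pos)
    show "?c k * (2 powr (a + real k + (b - 1 + real (m - k)) + 1) *
        Beta (a + real k + 1) (b - 1 + real (m - k) + 1)) =
        2 powr (a + b) * Gamma (real m + a + 1) * Gamma (real m + b + 1) /
        (Gamma (real m + a + b + 1) * fact m) *
        ((-1) ^ k * real (m choose k) / (b + real (m - k)))"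
      unfolding 1 2 3 4 5 binomial_fact [OF k]
      using pos [THEN less_imp_neq, THEN not_sym] by (simp add: divide_simps)
  qed
  also have "\<dots> = 2 powr (a + b) * Gamma (real m + a + 1) * Gamma (real m + b + 1) /
        (Gamma (real m + a + b + 1) * fact m) *
        (\<Sum>k\<le>m. (-1) ^ k * real (m choose k) / (b + real (m - k)))"
    by (simp add: sum_distrib_left)
  \<comment> \<open>Reversing the summation brings the denominators into the form
    \<open>b + real k\<close> and produces the overall sign \<open>(-1) ^ m\<close>.\<close>
  also have "(\<Sum>k\<le>m. (-1) ^ k * real (m choose k) / (b + real (m - k))) =
     (\<Sum>k\<le>m. (-1) ^ (m - k) * real (m choose (m - k)) / (b + real k))"
    by (rule sum.reindex_bij_witness [of _ "\<lambda>k. m - k" "\<lambda>k. m - k"]) auto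
  also have "\<dots> = (-1) ^ m * (\<Sum>k\<le>m. (-1) ^ k * real (m choose k) / (b + real k))"
    unfolding sum_distrib_left
    by (intro sum.cong refl) (auto simp: binomial_symmetric [symmetric] minus_one_power_iff)
  also have "\<dots> = (-1) ^ m * (fact m * Gamma b / Gamma (real m + b + 1))"
  proof -
    have "b \<notin> \<int>\<^sub>\<le>\<^sub>0" using assms by (auto elim!: nonpos_Ints_cases)
    then show ?thesis
      using assms by (simp add: sum_alternating_binomial_reciprocal pochhammer_Gamma add_ac
          del: pochhammer_Suc)
  qed
  also have "2 powr (a + b) * Gamma (real m + a + 1) * Gamma (real m + b + 1) /
        (Gamma (real m + a + b + 1) * fact m) * \<dots> =
      (-1) ^ m * 2 powr (a + b) * Gamma (real m + a + 1) * Gamma b / Gamma (real m + a + b + 1)"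
    using Gamma_real_pos [of "real m + b + 1", THEN less_imp_neq] assms by simp
  finally show ?thesis
    by (rule has_integral_eq [rotated]) (rule eq [symmetric])
qed

text \<open>The third hypothesis is what the rule gives for the Jacobi polynomial, and it determines
  \<open>v\<close>. Dividing the first conclusion by the squared leading coefficient yields the
  squared formula for the barycentric weight at -1.\<close>

lemma jacobi_const_norm:
  fixes a b v :: real
  assumes ab: "a > -1" "b > 0"
    and "v * poly (jacobi_poly (n + 1) a b) (-1) = (-1) ^ (n + 1) * 2 powr (a + b) *
      Gamma (real (n + 1) + a + 1) * Gamma b / Gamma (real (n + 1) + a + b + 1)"
  shows "(jacobi_const n a b)\<^sup>2 * (2 * b * v) * (poly (jacobi_poly (n + 1) a b) (-1))\<^sup>2 =
      (coeff (jacobi_poly (n + 1) a b) (n + 1))\<^sup>2"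
    and "v > 0" and "coeff (jacobi_poly (n + 1) a b) (n + 1) > 0"
proof -
  \<comment> \<open>In terms of the degree \<open>m\<close>, the argument
    \<open>2 * n + a + b + 3\<close> of the constant becomes \<open>2 * m + a + b + 1\<close>, as in
    the leading coefficient.\<close>
  define m where "m = n + 1"
  let ?P = "jacobi_poly m a b"
  define k where "k = coeff ?P m"
  note v = assms(3) [folded m_def]
  note b = ab(2)
  have k: "k = Gamma (2 * real m + a + b + 1) / (fact m * Gamma (real m + a + b + 1)) / 2 ^ m"
    unfolding k_def coeff_jacobi_poly using ab b
    by (subst gbinomial_Gamma) (auto simp: m_def algebra_simps)
  have e: "poly ?P (-1) = (-1) ^ m * (Gamma (real m + b + 1) / (fact m * (b * Gamma b)))"
  proof -
    have "Gamma (b + 1) = b * Gamma b"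
      using b by (intro Gamma_plus1) (auto elim!: nonpos_Ints_cases)
    then show ?thesis
      unfolding poly_jacobi_poly_minus_one using b by (subst gbinomial_Gamma) auto
  qed
  have pos: "Gamma (2 * real m + a + b + 1) > 0" "Gamma (real m + a + b + 1) > 0"
    "Gamma (real m + b + 1) > 0" "Gamma b > 0" "Gamma (real m + a + 1) > 0"
    using ab b by (auto intro!: Gamma_real_pos simp: m_def)
  then have kpos: "k > 0"
    unfolding k by simp
  let ?G = "Gamma (real m + b + 1) / (fact m * (b * Gamma b))"
  have G: "?G > 0"
    using pos b by simp
  have "(-1) ^ m * (v * ?G) = (-1) ^ m * (2 powr (a + b) * Gamma (real m + a + 1) * Gamma b / Gamma (real m + a + b + 1))"
    using v unfolding e by (simp only: mult_ac times_divide_eq_right)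
  then have v': "v * ?G = 2 powr (a + b) * Gamma (real m + a + 1) * Gamma b / Gamma (real m + a + b + 1)"
    by (simp only: mult_cancel_left) simp
  moreover have "\<dots> > 0"
    using pos by simp
  ultimately have vpos: "v > 0"
    using G by (metis zero_less_mult_pos2)
  \<comment> \<open>One factor of the square is absorbed with \<open>v\<close> into the known
    integral; the other is replaced by its explicit value.\<close>
  have "v * (poly ?P (-1))\<^sup>2 = v * ?G * ?G"
    unfolding e by (simp add: power_mult_distrib power2_eq_square)
  also have "\<dots> = 2 powr (a + b) * Gamma (real m + a + 1) * Gamma b / Gamma (real m + a + b + 1) * ?G"
    unfolding v' ..
  finally have vP: "v * (poly ?P (-1))\<^sup>2 =
      2 powr (a + b) * Gamma (real m + a + 1) * Gamma b / Gamma (real m + a + b + 1) * ?G" .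
  have C: "(jacobi_const n a b)\<^sup>2 = (Gamma (2 * real m + a + b + 1))\<^sup>2 /
    (4 ^ m * (2 * 2 powr (a + b)) * fact m * Gamma (real m + a + b + 1) *
      Gamma (real m + a + 1) * Gamma (real m + b + 1))"
    using ab b by (simp add: jacobi_const_square m_def powr_add algebra_simps)
  have "(jacobi_const n a b)\<^sup>2 * (2 * b * v) * (poly ?P (-1))\<^sup>2 =
      (jacobi_const n a b)\<^sup>2 * (2 * b) * (v * (poly ?P (-1))\<^sup>2)"
    by simp
  also have "\<dots> = k\<^sup>2"
  proof -
    have "(4::real) ^ m = (2 ^ m)\<^sup>2"
      by (simp add: power2_eq_square power_mult_distrib [symmetric])
    moreover have "(2::real) powr (a + b) > 0" by simp
    ultimately show ?thesis
      unfolding vP C k using pos [THEN less_imp_neq, THEN not_sym] b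
      by (simp add: power2_eq_square divide_simps)
  qed
  finally show "(jacobi_const n a b)\<^sup>2 * (2 * b * v) * (poly (jacobi_poly (n + 1) a b) (-1))\<^sup>2 =
      (coeff (jacobi_poly (n + 1) a b) (n + 1))\<^sup>2"
    by (simp only: m_def k_def)
  show "v > 0" by fact
  show "coeff (jacobi_poly (n + 1) a b) (n + 1) > 0"
    using kpos by (simp only: m_def k_def)
qed

lemma gauss_jacobi_radau_weight_minus_one:
  fixes \<alpha> \<beta> :: real
  assumes ab: "\<alpha> > -1" "\<beta> > -1" and rule: "gauss_jacobi_radau_rule \<alpha> \<beta> n x v w"
    and inj: "inj_on x {..n}" and roots: "x ` {..n} = {r. poly (jacobi_poly (n + 1) \<alpha> (\<beta> + 1)) r = 0}"
  shows "(jacobi_const n \<alpha> (\<beta> + 1))\<^sup>2 * (2 * (\<beta> + 1) * v) * (\<Prod>i\<le>n. -1 - x i)\<^sup>2 = 1"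
    and "v > 0"
proof -
  let ?P = "jacobi_poly (n + 1) \<alpha> (\<beta> + 1)"
  define k where "k = coeff ?P (n + 1)"
  have b: "\<beta> + 1 > 0" using ab(2) by simp
  have "poly ?P (x j) = 0" if "j \<le> n" for j
    using that roots by auto
  moreover have "degree ?P \<le> 2 * n + 2"
    by (rule order_trans [OF degree_jacobi_poly_le]) simp
  \<comment> \<open>The integral is taken with \<open>b = \<beta> + 1\<close>; the unfolding turns
    the weight exponent \<open>b - 1\<close> back into \<open>\<beta>\<close>.\<close>
  note gauss_jacobi_radau_rule_unique [OF rule this
    jacobi_poly_has_integral [OF ab(1) b, of "n + 1", unfolded add_diff_cancel_right']]
  ultimately have "v * poly ?P (-1) = (-1) ^ (n + 1) * 2 powr (\<alpha> + (\<beta> + 1)) *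
      Gamma (real (n + 1) + \<alpha> + 1) * Gamma (\<beta> + 1) / Gamma (real (n + 1) + \<alpha> + (\<beta> + 1) + 1)"
    by simp
  note norm = jacobi_const_norm [OF ab(1) b this, folded k_def]
  show "v > 0" by (fact norm)
  have "poly ?P (-1) = k * (\<Prod>i\<le>n. -1 - x i)"
    using arg_cong [OF jacobi_poly_eq_smult_prod [OF inj roots], of "\<lambda>p. poly p (-1)"]
    by (simp add: k_def poly_prod minus_diff_commute)
  with norm(1) have "k\<^sup>2 * ((jacobi_const n \<alpha> (\<beta> + 1))\<^sup>2 * (2 * (\<beta> + 1) * v) *
      (\<Prod>i\<le>n. -1 - x i)\<^sup>2) = k\<^sup>2 * 1"
    by (simp only: power_mult_distrib mult_ac)
  then show "(jacobi_const n \<alpha> (\<beta> + 1))\<^sup>2 * (2 * (\<beta> + 1) * v) * (\<Prod>i\<le>n. -1 - x i)\<^sup>2 = 1"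
    using norm(3) by (simp only: mult_cancel_left) simp
qed

section \<open>The barycentric weights of the Radau nodes\<close>

lemma gauss_jacobi_radau_weight_at_node:
  fixes \<alpha> \<beta> :: real and n :: nat and x w :: "nat \<Rightarrow> real" and v :: real
  assumes "\<alpha> > -1" and "\<beta> > -1"
    and "strict_mono_on {..n} x"
    and "x ` {..n} = {r. poly (jacobi_poly (n + 1) \<alpha> (\<beta> + 1)) r = 0}"
    and "gauss_jacobi_radau_rule \<alpha> \<beta> n x v w" and "j \<le> n"
  shows "x j > -1"
    and "(jacobi_const n \<alpha> (\<beta> + 1))\<^sup>2 * ((1 - x j) * w j) *
      ((1 + x j) * (\<Prod>i\<in>{..n} - {j}. x j - x i))\<^sup>2 = 1"
proof -
  have inj: "inj_on x {..n}"
    using assms(3) by (rule strict_mono_on_imp_inj_on)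
  note norm = gauss_jacobi_radau_weight_minus_one [OF assms(1,2,5) inj assms(4)]
  \<comment> \<open>The normalised product formula has value 1, so none of its factors is 0; in
    particular -1 is not a node \<open>x i\<close>.\<close>
  have Q: "(\<Prod>i\<le>n. -1 - x i) \<noteq> 0"
    using norm(1) by (metis mult_zero_right power_zero_numeral zero_neq_one)
  note node = gauss_jacobi_radau_node [OF assms(1,2) norm(2) assms(3,5,6) Q]
  show "x j > -1"
    by (fact node)
  \<comment> \<open>The identity at -1 replaces the right-hand side of the node relation, which
    eliminates \<open>v\<close>.\<close>
  have "(jacobi_const n \<alpha> (\<beta> + 1))\<^sup>2 *
      (w j * (1 - x j) * ((1 + x j) * (\<Prod>i\<in>{..n} - {j}. x j - x i))\<^sup>2) = 1"
    using node(2) norm(1) by (simp only: mult.assoc)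
  then show "(jacobi_const n \<alpha> (\<beta> + 1))\<^sup>2 * ((1 - x j) * w j) *
      ((1 + x j) * (\<Prod>i\<in>{..n} - {j}. x j - x i))\<^sup>2 = 1"
    by (simp only: mult_ac)
qed

lemma barycentric_weight_radau_node:
  fixes \<alpha> \<beta> :: real and n :: nat and x w :: "nat \<Rightarrow> real" and v :: real
  assumes "\<alpha> > -1" and "\<beta> > -1"
    and "strict_mono_on {..n} x"
    and "x ` {..n} = {r. poly (jacobi_poly (n + 1) \<alpha> (\<beta> + 1)) r = 0}"
    and "gauss_jacobi_radau_rule \<alpha> \<beta> n x v w" and j: "j \<le> n"
  shows "barycentric_weight (insert (-1) (x ` {..n})) (x j) =
    jacobi_const n \<alpha> (\<beta> + 1) * (-1) ^ j * sqrt ((1 - x j) * w j)"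
proof -
  have inj: "inj_on x {..n}"
    using assms(3) by (rule strict_mono_on_imp_inj_on)
  define C where "C = jacobi_const n \<alpha> (\<beta> + 1)"
  \<comment> \<open>The barycentric denominator of \<open>x j\<close>. Its factor
    \<open>1 + x j\<close> comes from the node -1 and is positive, so it does not affect the
    sign.\<close>
  define d where "d = (1 + x j) * (\<Prod>i\<in>{..n} - {j}. x j - x i)"
  have C: "C = (-1) ^ n * \<bar>C\<bar>"
    unfolding C_def using assms(1,2) by (intro jacobi_const_sgn_abs) auto
  note node = gauss_jacobi_radau_weight_at_node [OF assms(1-5)]
  have notin: "-1 \<notin> x ` {..n}"
    using node(1) by force
  have "\<bar>C\<bar>\<^sup>2 * ((1 - x j) * w j) * d\<^sup>2 = 1"
    using node(2) [OF j] by (simp only: C_def d_def power2_abs)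
  moreover have "(-1) ^ n * (-1) ^ j * d > 0"
    using mult_pos_pos [OF _ prod_node_differences_sign [OF assms(3) j], of "1 + x j"] node(1) [OF j]
    by (simp add: d_def mult_ac)
  ultimately have "inverse d = ((-1) ^ n * (-1) ^ j) * \<bar>C\<bar> * sqrt ((1 - x j) * w j)"
    by (intro inverse_eq_signed_sqrt) (auto simp: abs_mult)
  also have "\<dots> = ((-1) ^ n * \<bar>C\<bar>) * (-1) ^ j * sqrt ((1 - x j) * w j)"
    by simp
  finally show ?thesis
    using barycentric_weight_insert_image [OF _ notin inj, of j] j
    unfolding C_def [symmetric] by (simp add: d_def C [symmetric] add.commute)
qed

lemma barycentric_weight_radau_endpoint:
  fixes \<alpha> \<beta> :: real and n :: nat and x w :: "nat \<Rightarrow> real" and v :: real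
  assumes "\<alpha> > -1" and "\<beta> > -1"
    and "strict_mono_on {..n} x"
    and "x ` {..n} = {r. poly (jacobi_poly (n + 1) \<alpha> (\<beta> + 1)) r = 0}"
    and "gauss_jacobi_radau_rule \<alpha> \<beta> n x v w"
  shows "barycentric_weight (insert (-1) (x ` {..n})) (-1) =
    - jacobi_const n \<alpha> (\<beta> + 1) * sqrt (2 * (\<beta> + 1) * v)"
proof -
  have inj: "inj_on x {..n}"
    using assms(3) by (rule strict_mono_on_imp_inj_on)
  define C where "C = jacobi_const n \<alpha> (\<beta> + 1)"
  define Q where "Q = (\<Prod>i\<le>n. -1 - x i)"
  have C: "C = (-1) ^ n * \<bar>C\<bar>"
    unfolding C_def using assms(1,2) by (intro jacobi_const_sgn_abs) auto
  have norm: "C\<^sup>2 * (2 * (\<beta> + 1) * v) * Q\<^sup>2 = 1"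
    using gauss_jacobi_radau_weight_minus_one(1) [OF assms(1,2,5) inj assms(4)]
    by (simp only: C_def Q_def)
  note gt = gauss_jacobi_radau_weight_at_node(1) [OF assms]
  have notin: "-1 \<notin> x ` {..n}"
    using gt by force
  \<comment> \<open>\<open>Q\<close> has sign \<open>(-1) ^ (n + 1)\<close> but the constant has
    sign \<open>(-1) ^ n\<close>, whence the minus sign in the formula.\<close>
  have "inverse Q = - ((-1) ^ n) * \<bar>C\<bar> * sqrt (2 * (\<beta> + 1) * v)"
  proof (rule inverse_eq_signed_sqrt)
    show "- ((-1) ^ n) * Q > 0"
      unfolding Q_def using gt by (rule prod_left_endpoint_sign)
    show "\<bar>C\<bar>\<^sup>2 * (2 * (\<beta> + 1) * v) * Q\<^sup>2 = 1"
      using norm by simp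
  qed auto
  also have "\<dots> = - ((-1) ^ n * \<bar>C\<bar>) * sqrt (2 * (\<beta> + 1) * v)"
    by simp
  finally show ?thesis
    using barycentric_weight_insert_new [OF _ notin inj]
    unfolding C_def [symmetric] by (simp add: Q_def C [symmetric])
qed

theorem theorem11:
  fixes \<alpha> \<beta> :: real and n :: nat and x w :: "nat \<Rightarrow> real" and v :: real
  assumes "\<alpha> > -1" and "\<beta> > -1"
    and "strict_mono_on {..n} x"
    and "x ` {..n} = {r. poly (jacobi_poly (n + 1) \<alpha> (\<beta> + 1)) r = 0}"
    and "gauss_jacobi_radau_rule \<alpha> \<beta> n x v w"
  shows "(\<forall>j\<le>n. barycentric_weight (insert (-1) (x ` {..n})) (x j) =
             jacobi_const n \<alpha> (\<beta> + 1) * (-1) ^ j * sqrt ((1 - x j) * w j)) \<and>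
         barycentric_weight (insert (-1) (x ` {..n})) (-1) =
             - jacobi_const n \<alpha> (\<beta> + 1) * sqrt (2 * (\<beta> + 1) * v)"
  using barycentric_weight_radau_node [OF assms] barycentric_weight_radau_endpoint [OF assms] by blast

thm_deps theorem11

end
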